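(* Let $x_0$, $x_{ij}$ ($1\le i<j\le5$), $y_i,a_i,b_i$ ($1\le i\le 5$), $w$ be $27$ variables over $\mathbb{C}$, and let $P$ be the skew-symmetric $5\times5$ matrix with $(i,j)$ entry $x_{ij}$ for $i<j$. For $1\le i\le 5$ let $$q_i=x_0y_i+(-1)^{i-1}\operatorname{Pf}(P,i),\qquad q_i'=(y_1,y_2,y_3,y_4,y_5)\,P_i,$$ where $\operatorname{Pf}(P,i)$ is the Pfaffian of the $4\times4$ matrix obtained by deleting the $i$-th row and column of $P$, and $P_i$ is the $i$-th column of $P$. Let $$F_{\mathcal{C}}=\sum_{i=1}^5(q_ia_i+q_i'b_i)-w\sum_{i=1}^5a_ib_i ,$$ and let $\mathcal{H}(F_{\mathcal{C}})$ be the $27\times27$ Hessian matrix of second partial derivatives of $F_{\mathcal{C}}$ with respect to the $27$ variables. Then $\mathcal{H}(F_{\mathcal{C}})$ induces a matrix factorization of $F_{\mathcal{C}}$: there is a $27\times27$ matrix $\mathcal{Q}$ whose entries are quadratic forms in the $27$ variables such that $$\mathcal{H}(F_{\mathcal{C}})\,\mathcal{Q}=\mathcal{Q}\,\mathcal{H}(F_{\mathcal{C}})=F_{\mathcal{C}}\cdot \mathrm{Id}_{27}.$$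
   Context: The ground field is $\mathbb{C}$. For a polynomial $f$ in a polynomial ring $T$, a matrix factorization of $f$ is a pair $(A,B)$ of square matrices of the same size with entries in $T$ such that $AB=BA=f\cdot\mathrm{Id}$. Rows and columns of the Hessian are indexed by the same (arbitrary) ordering of the $27$ variables. *)

theory Defs
  imports "HOL-Analysis.Analysis" "HOL-Library.Poly_Mapping"
begin

text \<open>
  Polynomials over the complex numbers in a set of variables \<open>'v\<close>: finitely supported maps from
  monomials (exponent vectors) to coefficients, with the convolution product of
  \<open>HOL-Library.Poly_Mapping\<close>.
\<close>

type_synonym 'v cpoly = "('v \<Rightarrow>\<^sub>0 nat) \<Rightarrow>\<^sub>0 complex"

definition pvar :: "'v \<Rightarrow> 'v cpoly"
  where "pvar v = Poly_Mapping.single (Poly_Mapping.single v 1) 1"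

text \<open>
  If the exponent of \<open>v\<close> in \<open>m\<close> is zero, the subtraction below truncates, but the coefficient is
  then zero.
\<close>

definition partial_deriv :: "'v \<Rightarrow> 'v cpoly \<Rightarrow> 'v cpoly"
  where "partial_deriv v p =
    (\<Sum>m\<in>Poly_Mapping.keys p.
       Poly_Mapping.single (m - Poly_Mapping.single v 1)
         (of_nat (Poly_Mapping.lookup m v) * Poly_Mapping.lookup p m))"

definition hessian :: "('v::finite) cpoly \<Rightarrow> 'v cpoly ^ 'v ^ 'v"
  where "hessian p = (\<chi> u v. partial_deriv u (partial_deriv v p))"

definition homogeneous :: "nat \<Rightarrow> ('v::finite) cpoly \<Rightarrow> bool"
  where "homogeneous d p \<longleftrightarrow>
    (\<forall>m\<in>Poly_Mapping.keys p. (\<Sum>v\<in>UNIV. Poly_Mapping.lookup m v) = d)"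

definition matrix_factorization :: "'a::comm_ring_1 \<Rightarrow> 'a ^ 'n ^ 'n \<Rightarrow> 'a ^ 'n ^ ('n::finite) \<Rightarrow> bool"
  where "matrix_factorization f A B \<longleftrightarrow> A ** B = mat f \<and> B ** A = mat f"

text \<open>
  The Pfaffian of a skew-symmetric \<open>2n \<times> 2n\<close> matrix, with indices running from 1 to \<open>2n\<close>. The
  permutations summed over represent the perfect matchings
  \<open>{\<sigma> 1, \<sigma> 2}, \<dots>, {\<sigma> (2n-1), \<sigma> (2n)}\<close> of \<open>{1..2n}\<close>, each exactly once.
\<close>

definition pfaffian :: "nat \<Rightarrow> (nat \<Rightarrow> nat \<Rightarrow> 'a::comm_ring_1) \<Rightarrow> 'a"
  where "pfaffian n M =
    (\<Sum>\<sigma> | \<sigma> permutes {1..2 * n} \<and>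
           (\<forall>k\<in>{1..n}. \<sigma> (2 * k - 1) < \<sigma> (2 * k)) \<and>
           (\<forall>k\<in>{1..<n}. \<sigma> (2 * k - 1) < \<sigma> (2 * k + 1)).
       of_int (sign \<sigma>) * (\<Prod>k = 1..n. M (\<sigma> (2 * k - 1)) (\<sigma> (2 * k))))"

definition delete_row_col :: "nat \<Rightarrow> (nat \<Rightarrow> nat \<Rightarrow> 'a) \<Rightarrow> nat \<Rightarrow> nat \<Rightarrow> 'a"
  where "delete_row_col i M r c = M (if r < i then r else r + 1) (if c < i then c else c + 1)"

datatype var =
    X0
  | X12 | X13 | X14 | X15 | X23 | X24 | X25 | X34 | X35 | X45
  | Y1 | Y2 | Y3 | Y4 | Y5
  | A1 | A2 | A3 | A4 | A5
  | B1 | B2 | B3 | B4 | B5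
  | W

lemma UNIV_var:
  "UNIV = {X0, X12, X13, X14, X15, X23, X24, X25, X34, X35, X45,
           Y1, Y2, Y3, Y4, Y5, A1, A2, A3, A4, A5, B1, B2, B3, B4, B5, W}"
  by (auto intro: var.exhaust)

instance var :: finite
  by standard (simp add: UNIV_var)

lemma card_var: "CARD(var) = 27"
  by (simp add: UNIV_var)

text \<open>
  The variables as polynomials. The index functions are meaningful for \<open>1 \<le> i < j \<le> 5\<close>
  (\<open>x\<close>) and \<open>1 \<le> i \<le> 5\<close> (\<open>y\<close>, \<open>a\<close>, \<open>b\<close>) only.
\<close>

definition x0_var :: "var cpoly"
  where "x0_var = pvar X0"

definition x_var :: "nat \<Rightarrow> nat \<Rightarrow> var cpoly"
  where "x_var i j = pvar ([[X12, X13, X14, X15], [X23, X24, X25], [X34, X35], [X45]] ! (i - 1) ! (j - i - 1))"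

definition y_var :: "nat \<Rightarrow> var cpoly"
  where "y_var i = pvar ([Y1, Y2, Y3, Y4, Y5] ! (i - 1))"

definition a_var :: "nat \<Rightarrow> var cpoly"
  where "a_var i = pvar ([A1, A2, A3, A4, A5] ! (i - 1))"

definition b_var :: "nat \<Rightarrow> var cpoly"
  where "b_var i = pvar ([B1, B2, B3, B4, B5] ! (i - 1))"

definition w_var :: "var cpoly"
  where "w_var = pvar W"

definition skew_P :: "nat \<Rightarrow> nat \<Rightarrow> var cpoly"
  where "skew_P i j = (if i < j then x_var i j else if j < i then - x_var j i else 0)"

definition q_poly :: "nat \<Rightarrow> var cpoly"
  where "q_poly i = x0_var * y_var i + (-1) ^ (i - 1) * pfaffian 2 (delete_row_col i skew_P)"

definition q_poly' :: "nat \<Rightarrow> var cpoly"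
  where "q_poly' i = (\<Sum>j = 1..5. y_var j * skew_P j i)"

definition F_C :: "var cpoly"
  where "F_C = (\<Sum>i = 1..5. q_poly i * a_var i + q_poly' i * b_var i) - w_var * (\<Sum>i = 1..5. a_var i * b_var i)"

end

theory Submission
  imports Defs
begin

text \<open>
  The cubic \<open>F\<close> of the theorem is the \<open>E\<^sub>6\<close>-invariant cubic on the 27-dimensional representation,
  that is, the norm of the complex exceptional Jordan algebra. In the given coordinates it is a
  signed sum of 45 monomials, and its gradient \<open>g = \<nabla>F\<close>, a vector of 27 quadratic forms, plays the
  role of the adjoint map \<open>x \<mapsto> x\<^sup>#\<close>. The adjoint identity \<open>x\<^sup>#\<^sup># = N(x) x\<close> here reads
  \<open>g(g(x)) = F(x) x\<close> (lemma \<open>adjoint_cartan\<close>); the dual cubic has the same coefficients as \<open>F\<close>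
  in these coordinates, so that \<open>g\<close> may be composed with itself.

  The factorization is the derivative of this identity. Write \<open>H(x)\<close> for the Hessian of \<open>F\<close>, which
  is also the Jacobian of \<open>g\<close>. The chain rule gives
  \<open>H(g(x)) H(x) = F(x) Id + x g(x)\<^sup>T\<close>, and Euler's relation for the quadratic forms \<open>g\<close> gives
  \<open>x\<^sup>T H(x) = 2 g(x)\<^sup>T\<close>. Hence the rank-one error is removed by
  \<open>Q(x) = H(g(x)) - 1/2 x x\<^sup>T\<close>, whose entries are quadratic forms and which satisfies \<open>Q H = F Id\<close>.
  Both matrices are symmetric, so transposing gives \<open>H Q = F Id\<close>. This step works for every cubic form
  that satisfies the adjoint identity (theorem \<open>hessian_matrix_factorization\<close>).
\<close>

section \<open>Partial derivatives of polynomials\<close>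

text \<open>
  Describing the derivative by its coefficients removes the dependence of the defining sum on the
  support of \<open>p\<close>, which is what makes additivity immediate.
\<close>

lemma lookup_partial_deriv:
  "Poly_Mapping.lookup (partial_deriv v p) m =
    of_nat (Poly_Mapping.lookup m v + 1) * Poly_Mapping.lookup p (m + Poly_Mapping.single v 1)"
proof -
  let ?s = "Poly_Mapping.single v (1::nat)"
  have shift: "k - ?s = m \<and> Poly_Mapping.lookup k v \<noteq> 0 \<longleftrightarrow> k = m + ?s" for k
  proof
    assume k: "k - ?s = m \<and> Poly_Mapping.lookup k v \<noteq> 0"
    have "Poly_Mapping.lookup k u = Poly_Mapping.lookup ((k - ?s) + ?s) u" for u
      using k by (auto simp: lookup_add lookup_minus lookup_single when_def)
    with k show "k = m + ?s" by (metis poly_mapping_eqI)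
  qed (simp add: lookup_add)
  have "Poly_Mapping.lookup (partial_deriv v p) m =
      (\<Sum>k\<in>Poly_Mapping.keys p.
        if k = m + ?s then of_nat (Poly_Mapping.lookup k v) * Poly_Mapping.lookup p k else 0)"
    unfolding partial_deriv_def lookup_sum
  proof (intro sum.cong refl)
    fix k
    show "Poly_Mapping.lookup
        (Poly_Mapping.single (k - ?s) (of_nat (Poly_Mapping.lookup k v) * Poly_Mapping.lookup p k)) m =
        (if k = m + ?s then of_nat (Poly_Mapping.lookup k v) * Poly_Mapping.lookup p k else 0)"
      using shift[of k] by (auto simp: lookup_single when_def)
  qed
  also have "\<dots> = of_nat (Poly_Mapping.lookup m v + 1) * Poly_Mapping.lookup p (m + ?s)"
    by (simp add: sum.delta lookup_add in_keys_iff)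
  finally show ?thesis .
qed

lemma partial_deriv_add: "partial_deriv v (p + q) = partial_deriv v p + partial_deriv v q"
  by (rule poly_mapping_eqI) (simp add: lookup_partial_deriv lookup_add algebra_simps)

lemma partial_deriv_zero: "partial_deriv v 0 = 0"
  by (simp add: partial_deriv_def)

lemma partial_deriv_single:
  "partial_deriv v (Poly_Mapping.single m c) =
    Poly_Mapping.single (m - Poly_Mapping.single v 1) (of_nat (Poly_Mapping.lookup m v) * c)"
  by (simp add: partial_deriv_def)

lemma partial_deriv_pvar: "partial_deriv v (pvar w) = of_bool (w = v)"
  by (auto simp: pvar_def partial_deriv_single lookup_single)

lemma poly_mapping_single_induct [case_names zero single add]:
  fixes p :: "'a \<Rightarrow>\<^sub>0 'b::comm_monoid_add"
  assumes "P 0" "\<And>m c. P (Poly_Mapping.single m c)" "\<And>p q. P p \<Longrightarrow> P q \<Longrightarrow> P (p + q)"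
  shows "P p"
proof (induction p rule: update_induct)
  case const
  show ?case by (fact assms(1))
next
  case (update p m c)
  have "Poly_Mapping.update m c p = p + Poly_Mapping.single m c"
    using update.hyps by (intro poly_mapping_eqI)
      (auto simp: lookup_update lookup_add lookup_single when_def in_keys_iff)
  with update.IH assms(2,3) show ?case by metis
qed

text \<open>
  The exponent subtraction truncates when \<open>v\<close> does not divide \<open>m\<close>, and then the two exponents may
  differ; the coefficient is then zero.
\<close>

lemma monomial_deriv_shift:
  fixes m n :: "'v \<Rightarrow>\<^sub>0 nat"
  shows "Poly_Mapping.single (m + n - Poly_Mapping.single v 1)
      (of_nat (Poly_Mapping.lookup m v) * c) =
    Poly_Mapping.single (m - Poly_Mapping.single v 1 + n)
      (of_nat (Poly_Mapping.lookup m v) * c :: 'b::comm_semiring_1)"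
proof (cases "Poly_Mapping.lookup m v = 0")
  case False
  have "m + n - Poly_Mapping.single v 1 = m - Poly_Mapping.single v 1 + n"
    using False by (intro poly_mapping_eqI) (auto simp: lookup_add lookup_minus lookup_single when_def)
  then show ?thesis by simp
qed simp

lemma partial_deriv_mult:
  "partial_deriv v (p * q) = partial_deriv v p * q + p * partial_deriv v q"
proof (induction p rule: poly_mapping_single_induct)
  case zero
  show ?case by (simp add: partial_deriv_zero)
next
  case (single m c)
  show ?case
  proof (induction q rule: poly_mapping_single_induct)
    case zero
    show ?case by (simp add: partial_deriv_zero)
  next
    case (single n d)
    have "partial_deriv v (Poly_Mapping.single m c * Poly_Mapping.single n d) =
        Poly_Mapping.single (m + n - Poly_Mapping.single v 1)
          (of_nat (Poly_Mapping.lookup m v) * (c * d)) +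
        Poly_Mapping.single (n + m - Poly_Mapping.single v 1)
          (of_nat (Poly_Mapping.lookup n v) * (c * d))"
      by (simp add: mult_single partial_deriv_single lookup_add algebra_simps flip: single_add)
    also have "\<dots> = partial_deriv v (Poly_Mapping.single m c) * Poly_Mapping.single n d +
        Poly_Mapping.single m c * partial_deriv v (Poly_Mapping.single n d)"
      unfolding monomial_deriv_shift
      by (simp add: mult_single partial_deriv_single algebra_simps)
    finally show ?case .
  qed (simp add: partial_deriv_add algebra_simps)
qed (simp add: partial_deriv_add algebra_simps)

text \<open>
  The chain rules for cubic forms and their gradients follow from additivity and the Leibniz rule
  alone.
\<close>

locale derivation =
  fixes D :: "'a::comm_ring_1 \<Rightarrow> 'a"
  assumes add: "D (p + q) = D p + D q"
    and mult: "D (p * q) = D p * q + p * D q"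
begin

lemma zero: "D 0 = 0"
  using add[of 0 0] by simp

lemma one: "D 1 = 0"
  using mult[of 1 1] by simp

lemma minus: "D (- p) = - D p"
  using add[of p "- p"] by (simp add: zero minus_unique)

lemma of_nat: "D (of_nat n) = 0"
  by (induction n) (simp_all add: zero one add)

lemma of_int: "D (of_int k) = 0"
  by (cases k rule: int_cases2) (simp_all add: minus of_nat)

lemma of_bool: "D (of_bool b) = 0"
  by (cases b) (simp_all add: zero one)

end

lemma derivation_partial_deriv: "derivation (partial_deriv v)"
  by unfold_locales (fact partial_deriv_add partial_deriv_mult)+

section \<open>Homogeneous polynomials\<close>

lemma homogeneous_zero: "homogeneous d 0"
  by (simp add: homogeneous_def)

lemma homogeneous_add: "homogeneous d p \<Longrightarrow> homogeneous d q \<Longrightarrow> homogeneous d (p + q)"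
  using keys_add[of p q] by (auto simp: homogeneous_def)

lemma homogeneous_minus: "homogeneous d p \<Longrightarrow> homogeneous d (- p)"
  by (simp add: homogeneous_def in_keys_iff)

lemma homogeneous_diff: "homogeneous d p \<Longrightarrow> homogeneous d q \<Longrightarrow> homogeneous d (p - q)"
  using homogeneous_add[OF _ homogeneous_minus, of d p q] by simp

lemma homogeneous_mult: "homogeneous d p \<Longrightarrow> homogeneous e q \<Longrightarrow> homogeneous (d + e) (p * q)"
  using keys_mult[of p q] by (fastforce simp: homogeneous_def lookup_add sum.distrib)

lemma homogeneous_const: "homogeneous 0 (Poly_Mapping.single 0 c)"
  by (simp add: homogeneous_def)

lemma homogeneous_pvar: "homogeneous 1 (pvar v)"
  by (simp add: homogeneous_def pvar_def lookup_single when_def)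

lemma homogeneous_of_int: "homogeneous 0 (of_int k)"
  using homogeneous_const[of "of_int k"] by simp

lemma homogeneous_of_bool: "homogeneous 0 (of_bool b)"
  using homogeneous_of_int[of "of_bool b"] by simp

lemma homogeneous_sum_list: "(\<And>p. p \<in> set ps \<Longrightarrow> homogeneous d p) \<Longrightarrow> homogeneous d (sum_list ps)"
  by (induction ps) (auto intro: homogeneous_zero homogeneous_add)

section \<open>Cubic forms, their gradients and their Hessians\<close>

text \<open>
  A cubic form is represented by the list of its terms \<open>(s, a, b, c)\<close>, standing for
  \<open>s x\<^sub>a x\<^sub>b x\<^sub>c\<close>, rather than by a polynomial: its gradient and Hessian can then be evaluated at any
  point of any commutative ring, in particular both at the variables and at the gradient itself,
  and the chain rule can be proved term by term. Repeated indices \<open>a = b\<close> are allowed and are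
  counted correctly, because each of the three positions is differentiated separately.
\<close>

type_synonym 'v cubic_terms = "(int \<times> 'v \<times> 'v \<times> 'v) list"

definition form :: "'v cubic_terms \<Rightarrow> ('v \<Rightarrow> 'a::comm_ring_1) \<Rightarrow> 'a"
  where "form T x = (\<Sum>(s, a, b, c)\<leftarrow>T. of_int s * (x a * x b * x c))"

definition grad :: "'v cubic_terms \<Rightarrow> ('v \<Rightarrow> 'a::comm_ring_1) \<Rightarrow> 'v \<Rightarrow> 'a"
  where "grad T x u = (\<Sum>(s, a, b, c)\<leftarrow>T. of_int s *
    (of_bool (a = u) * (x b * x c) + of_bool (b = u) * (x a * x c) + of_bool (c = u) * (x a * x b)))"

definition hess :: "'v cubic_terms \<Rightarrow> ('v \<Rightarrow> 'a::comm_ring_1) \<Rightarrow> 'v \<Rightarrow> 'v \<Rightarrow> 'a"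
  where "hess T x u v = (\<Sum>(s, a, b, c)\<leftarrow>T. of_int s *
    (of_bool (a = u) * (of_bool (b = v) * x c + of_bool (c = v) * x b) +
     of_bool (b = u) * (of_bool (a = v) * x c + of_bool (c = v) * x a) +
     of_bool (c = u) * (of_bool (a = v) * x b + of_bool (b = v) * x a)))"

lemma hess_sym: "hess T x u v = hess T x v u"
  unfolding hess_def
  by (intro arg_cong[of _ _ sum_list] map_cong refl) (auto simp: algebra_simps)

lemma sum_of_bool_mult:
  fixes f :: "'v::finite \<Rightarrow> 'a::comm_ring_1"
  shows "(\<Sum>w\<in>UNIV. of_bool (a = w) * f w) = f a"
  by (simp add: of_bool_def if_distrib[of "\<lambda>t. t * _"] sum.delta' cong: if_cong)

lemma hess_euler:
  fixes x :: "'v::finite \<Rightarrow> 'a::comm_ring_1"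
  shows "(\<Sum>w\<in>UNIV. hess T x u w * x w) = 2 * grad T x u"
proof (induction T)
  case Nil
  show ?case by (simp add: hess_def grad_def)
next
  case (Cons t T)
  obtain s a b c where t: "t = (s, a, b, c)" by (cases t)
  have "(\<Sum>w\<in>UNIV. hess (t # T) x u w * x w) =
      (\<Sum>w\<in>UNIV. of_bool (a = w) * (of_int s * (of_bool (b = u) * x c + of_bool (c = u) * x b) * x w)) +
      (\<Sum>w\<in>UNIV. of_bool (b = w) * (of_int s * (of_bool (a = u) * x c + of_bool (c = u) * x a) * x w)) +
      (\<Sum>w\<in>UNIV. of_bool (c = w) * (of_int s * (of_bool (a = u) * x b + of_bool (b = u) * x a) * x w)) +
      (\<Sum>w\<in>UNIV. hess T x u w * x w)"
    by (simp only: flip: sum.distrib) (rule sum.cong, simp, simp add: t hess_def algebra_simps)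
  then show ?case
    unfolding sum_of_bool_mult Cons.IH by (simp add: t grad_def algebra_simps)
qed

context derivation
begin

lemma form_chain_rule:
  fixes x :: "'v::finite \<Rightarrow> 'a"
  shows "D (form T x) = (\<Sum>w\<in>UNIV. grad T x w * D (x w))"
proof (induction T)
  case Nil
  show ?case by (simp add: form_def grad_def zero)
next
  case (Cons t T)
  obtain s a b c where t: "t = (s, a, b, c)" by (cases t)
  have "(\<Sum>w\<in>UNIV. grad (t # T) x w * D (x w)) =
      (\<Sum>w\<in>UNIV. of_bool (a = w) * (of_int s * (x b * x c) * D (x w))) +
      (\<Sum>w\<in>UNIV. of_bool (b = w) * (of_int s * (x a * x c) * D (x w))) +
      (\<Sum>w\<in>UNIV. of_bool (c = w) * (of_int s * (x a * x b) * D (x w))) +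
      (\<Sum>w\<in>UNIV. grad T x w * D (x w))"
    by (simp only: flip: sum.distrib) (rule sum.cong, simp, simp add: t grad_def algebra_simps)
  moreover have "D (form (t # T) x) = D (of_int s * (x a * x b * x c)) + D (form T x)"
    by (simp add: t form_def add)
  ultimately show ?case
    unfolding sum_of_bool_mult Cons.IH by (simp add: mult of_int algebra_simps)
qed

lemma grad_chain_rule:
  fixes x :: "'v::finite \<Rightarrow> 'a"
  shows "D (grad T x u) = (\<Sum>w\<in>UNIV. hess T x u w * D (x w))"
proof (induction T)
  case Nil
  show ?case by (simp add: hess_def grad_def zero)
next
  case (Cons t T)
  obtain s a b c where t: "t = (s, a, b, c)" by (cases t)
  have "(\<Sum>w\<in>UNIV. hess (t # T) x u w * D (x w)) =
      (\<Sum>w\<in>UNIV. of_bool (a = w) * (of_int s * (of_bool (b = u) * x c + of_bool (c = u) * x b) * D (x w))) +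
      (\<Sum>w\<in>UNIV. of_bool (b = w) * (of_int s * (of_bool (a = u) * x c + of_bool (c = u) * x a) * D (x w))) +
      (\<Sum>w\<in>UNIV. of_bool (c = w) * (of_int s * (of_bool (a = u) * x b + of_bool (b = u) * x a) * D (x w))) +
      (\<Sum>w\<in>UNIV. hess T x u w * D (x w))"
    by (simp only: flip: sum.distrib) (rule sum.cong, simp, simp add: t hess_def algebra_simps)
  moreover have "D (grad (t # T) x u) =
      D (of_int s * (of_bool (a = u) * (x b * x c) + of_bool (b = u) * (x a * x c) +
        of_bool (c = u) * (x a * x b))) + D (grad T x u)"
    by (simp add: t grad_def add)
  ultimately show ?case
    unfolding sum_of_bool_mult Cons.IH by (simp add: mult add of_int of_bool algebra_simps)
qed

end

lemma partial_deriv_form: "partial_deriv v (form T pvar) = grad T (pvar :: 'v::finite \<Rightarrow> _) v"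
  using sum_of_bool_mult[of v "grad T pvar"]
  by (simp add: derivation.form_chain_rule[OF derivation_partial_deriv] partial_deriv_pvar mult.commute eq_commute)

lemma partial_deriv_grad: "partial_deriv v (grad T pvar u) = hess T (pvar :: 'v::finite \<Rightarrow> _) u v"
  using sum_of_bool_mult[of v "hess T pvar u"]
  by (simp add: derivation.grad_chain_rule[OF derivation_partial_deriv] partial_deriv_pvar mult.commute eq_commute)

lemma hessian_form: "hessian (form T pvar) = (\<chi> u v. hess T (pvar :: 'v::finite \<Rightarrow> _) u v)"
  by (simp add: hessian_def partial_deriv_form partial_deriv_grad hess_sym[of T pvar])

lemma homogeneous_grad: "homogeneous 2 (grad T (pvar :: 'v::finite \<Rightarrow> _) u)"
proof -
  have quad: "homogeneous 2 (of_bool e * (pvar a * pvar b))" for e and a b :: 'v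
    using homogeneous_mult[OF homogeneous_of_bool homogeneous_mult[OF homogeneous_pvar homogeneous_pvar]]
    by (metis add_0 one_add_one)
  have scale: "homogeneous 2 (of_int s * p)" if "homogeneous 2 p" for s and p :: "'v cpoly"
    using homogeneous_mult[OF homogeneous_of_int that] by (metis add_0)
  show ?thesis
    unfolding grad_def by (rule homogeneous_sum_list) (auto intro!: scale homogeneous_add quad)
qed

lemma homogeneous_hess:
  assumes "\<And>v. homogeneous d (x v)"
  shows "homogeneous d (hess T x u v)"
proof -
  have scale: "homogeneous d (of_int s * p)" if "homogeneous d p" for s p
    using homogeneous_mult[OF homogeneous_of_int that] by simp
  have select: "homogeneous d (of_bool e * p)" if "homogeneous d p" for e p
    using homogeneous_mult[OF homogeneous_of_bool that] by simp
  show ?thesis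
    unfolding hess_def
    by (rule homogeneous_sum_list) (auto intro!: scale homogeneous_add select assms)
qed

text \<open>
  Differentiating the adjoint identity inverts the Hessian up to the rank-one term
  \<open>x g(x)\<^sup>T\<close>, and Euler's relation identifies that term as half of \<open>x x\<^sup>T H(x)\<close>.
\<close>

theorem hessian_matrix_factorization:
  fixes T :: "('v::finite) cubic_terms"
  assumes adjoint: "\<And>u. grad T (grad T pvar) u = form T pvar * pvar u"
  shows "\<exists>Q. (\<forall>u v. homogeneous 2 (Q $ u $ v)) \<and>
    matrix_factorization (form T pvar) (hessian (form T pvar)) Q"
proof -
  let ?F = "form T pvar" and ?g = "grad T pvar"
  let ?H = "hess T pvar" and ?K = "hess T (grad T pvar)"
  define h :: "'v cpoly" where "h = Poly_Mapping.single 0 (1 / 2)"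
  \<comment> \<open>The numeral \<open>2\<close> is the constant polynomial \<open>2\<close>, so \<open>h\<close> is its inverse.\<close>
  have h: "h * 2 = 1"
  proof -
    have "h * 2 = h * Poly_Mapping.single 0 2" by simp
    also have "\<dots> = 1" unfolding h_def mult_single by simp
    finally show ?thesis .
  qed
  define Q where "Q = (\<chi> u v. ?K u v - h * (pvar u * pvar v))"
  have sym: "transpose (hessian ?F) = hessian ?F" "transpose Q = Q"
    by (simp_all add: transpose_def hessian_form Q_def vec_eq_iff hess_sym mult.commute)
  \<comment> \<open>Both sides are the derivative of the adjoint identity with respect to \<open>v\<close>.\<close>
  have chain: "(\<Sum>w\<in>UNIV. ?K u w * ?H w v) = ?F * of_bool (u = v) + ?g v * pvar u" for u v
  proof -
    have "(\<Sum>w\<in>UNIV. ?K u w * ?H w v) = partial_deriv v (grad T ?g u)"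
      unfolding derivation.grad_chain_rule[OF derivation_partial_deriv, of v T "?g" u] partial_deriv_grad ..
    also have "\<dots> = ?F * of_bool (u = v) + ?g v * pvar u"
      by (simp add: adjoint partial_deriv_mult partial_deriv_form partial_deriv_pvar)
    finally show ?thesis .
  qed
  have euler: "(\<Sum>w\<in>UNIV. pvar w * ?H w v) = 2 * ?g v" for v
    using hess_euler[of T pvar v] by (simp add: hess_sym[of T pvar _ v] mult.commute)
  have QH: "Q ** hessian ?F = mat ?F"
  proof -
    have "(\<Sum>w\<in>UNIV. (?K u w - h * (pvar u * pvar w)) * ?H w v) = (if u = v then ?F else 0)" for u v
    proof -
      have "(\<Sum>w\<in>UNIV. (?K u w - h * (pvar u * pvar w)) * ?H w v) =
          (\<Sum>w\<in>UNIV. ?K u w * ?H w v) - h * pvar u * (\<Sum>w\<in>UNIV. pvar w * ?H w v)"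
        by (simp add: sum_distrib_left left_diff_distrib sum_subtractf mult.assoc)
      also have "\<dots> = ?F * of_bool (u = v) + ?g v * pvar u - (h * 2) * (pvar u * ?g v)"
        unfolding chain euler by (simp add: algebra_simps)
      finally show ?thesis by (simp add: h mult.commute)
    qed
    then show ?thesis
      by (simp add: Q_def hessian_form matrix_matrix_mult_def mat_def vec_eq_iff)
  qed
  have "hessian ?F ** Q = transpose (Q ** hessian ?F)"
    by (simp only: matrix_transpose_mul sym)
  also have "\<dots> = mat ?F" by (simp add: QH transpose_mat)
  finally have HQ: "hessian ?F ** Q = mat ?F" .
  have "homogeneous 2 (Q $ u $ v)" for u v
    using homogeneous_mult[OF homogeneous_const homogeneous_mult[OF homogeneous_pvar homogeneous_pvar]]
    by (auto simp: Q_def h_def numeral_2_eq_2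
        intro!: homogeneous_diff homogeneous_hess homogeneous_grad[unfolded numeral_2_eq_2])
  with QH HQ show ?thesis unfolding matrix_factorization_def by blast
qed

section \<open>The cubic of the theorem\<close>

text \<open>
  The three permutations that occur in the definition of the Pfaffian for \<open>n = 2\<close> are, in one-line
  notation, \<open>1234\<close>, \<open>1324\<close> and \<open>1423\<close>: the constraints force \<open>\<sigma> 1 = 1\<close>, and the choice of \<open>\<sigma> 2\<close>
  determines the rest.
\<close>

lemma pfaffian_2: "pfaffian 2 M = M 1 2 * M 3 4 - M 1 3 * M 2 4 + M 1 4 * M 2 3"
proof -
  define id4 :: "nat \<Rightarrow> nat" where "id4 = id"
  define s where "s = Transposition.transpose (2::nat) 3"
  define t where "t = Transposition.transpose (3::nat) 4 \<circ> Transposition.transpose 2 3"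
  let ?S = "{\<sigma>. \<sigma> permutes {1..2 * 2::nat} \<and> (\<forall>k\<in>{1..2}. \<sigma> (2 * k - 1) < \<sigma> (2 * k)) \<and>
    (\<forall>k\<in>{1..<2}. \<sigma> (2 * k - 1) < \<sigma> (2 * k + 1))}"
  have I: "{1..2 * 2::nat} = {1, 2, 3, 4}" "{1..2::nat} = {1, 2}" "{1..<2::nat} = {1}" by auto
  have vals: "id4 1 = 1" "id4 2 = 2" "id4 3 = 3" "id4 4 = 4"
      "s 1 = 1" "s 2 = 3" "s 3 = 2" "s 4 = 4" "t 1 = 1" "t 2 = 4" "t 3 = 2" "t 4 = 3"
    by (simp_all add: id4_def s_def t_def Transposition.transpose_def)
  have perm: "id4 permutes {1, 2, 3, 4}" "s permutes {1, 2, 3, 4}" "t permutes {1, 2, 3, 4}"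
    unfolding id4_def s_def t_def
    by (auto intro!: permutes_id permutes_swap_id permutes_compose)
  have "?S = {id4, s, t}"
  proof (intro equalityI subsetI)
    fix \<sigma> assume "\<sigma> \<in> ?S"
    then have \<sigma>: "\<sigma> permutes {1, 2, 3, 4}" and
      less: "\<sigma> 1 < \<sigma> 2" "\<sigma> 3 < \<sigma> 4" "\<sigma> 1 < \<sigma> 3"
      unfolding I by simp_all
    have range: "\<sigma> k \<in> {1, 2, 3, 4}" if "k \<in> {1, 2, 3, 4}" for k
      using permutes_in_image[OF \<sigma>] that by blast
    have "\<sigma> 2 \<noteq> \<sigma> 3" "\<sigma> 2 \<noteq> \<sigma> 4"
      using permutes_inj[OF \<sigma>] by (simp_all add: inj_eq)
    then have cases: "\<sigma> 1 = 1 \<and> (\<sigma> 2 = 2 \<and> \<sigma> 3 = 3 \<and> \<sigma> 4 = 4 \<or>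
        \<sigma> 2 = 3 \<and> \<sigma> 3 = 2 \<and> \<sigma> 4 = 4 \<or> \<sigma> 2 = 4 \<and> \<sigma> 3 = 2 \<and> \<sigma> 4 = 3)"
    proof -
      have "1 \<le> \<sigma> 1" "\<sigma> 2 \<le> 4" "\<sigma> 4 \<le> 4"
        using range[of 1] range[of 2] range[of 4] by auto
      with less \<open>\<sigma> 2 \<noteq> \<sigma> 3\<close> \<open>\<sigma> 2 \<noteq> \<sigma> 4\<close> show ?thesis
        by arith
    qed
    have eqI: "\<sigma> = \<tau>" if "\<tau> permutes {1, 2, 3, 4}" "\<forall>k\<in>{1, 2, 3, 4}. \<sigma> k = \<tau> k" for \<tau>
      using that \<sigma> by (metis ext permutes_not_in)
    from cases show "\<sigma> \<in> {id4, s, t}"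
      using eqI[OF perm(1)] eqI[OF perm(2)] eqI[OF perm(3)] vals by auto
  next
    fix \<sigma> assume "\<sigma> \<in> {id4, s, t}"
    then show "\<sigma> \<in> ?S" unfolding I using perm vals by auto
  qed
  moreover have "id4 \<noteq> s" "id4 \<noteq> t" "s \<noteq> t"
    using vals by (metis numeral_eq_iff semiring_norm(88,89))+
  moreover have "sign id4 = 1" "sign s = -1" "sign t = 1"
    unfolding id4_def s_def t_def
    by (simp_all add: sign_swap_id sign_compose permutation_swap_id)
  ultimately show ?thesis
    unfolding pfaffian_def by (simp only: I) (use vals in simp)
qed

text \<open>
  The five blocks of nine terms collect the multiples of \<open>a\<^sub>i\<close> and \<open>b\<^sub>i\<close>, for \<open>i = 1, \<dots>, 5\<close>: first
  \<open>q\<^sub>i a\<^sub>i\<close>, then \<open>q'\<^sub>i b\<^sub>i\<close>, then \<open>-w a\<^sub>i b\<^sub>i\<close>.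
\<close>

definition cartan_terms :: "var cubic_terms"
  where "cartan_terms = [
    (1, X0, Y1, A1),
    (1, X23, X45, A1),
    (-1, X24, X35, A1),
    (1, X25, X34, A1),
    (-1, Y2, X12, B1),
    (-1, Y3, X13, B1),
    (-1, Y4, X14, B1),
    (-1, Y5, X15, B1),
    (-1, W, A1, B1),
    (1, X0, Y2, A2),
    (-1, X13, X45, A2),
    (1, X14, X35, A2),
    (-1, X15, X34, A2),
    (1, Y1, X12, B2),
    (-1, Y3, X23, B2),
    (-1, Y4, X24, B2),
    (-1, Y5, X25, B2),
    (-1, W, A2, B2),
    (1, X0, Y3, A3),
    (1, X12, X45, A3),
    (-1, X14, X25, A3),
    (1, X15, X24, A3),
    (1, Y1, X13, B3),
    (1, Y2, X23, B3),
    (-1, Y4, X34, B3),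
    (-1, Y5, X35, B3),
    (-1, W, A3, B3),
    (1, X0, Y4, A4),
    (-1, X12, X35, A4),
    (1, X13, X25, A4),
    (-1, X15, X23, A4),
    (1, Y1, X14, B4),
    (1, Y2, X24, B4),
    (1, Y3, X34, B4),
    (-1, Y5, X45, B4),
    (-1, W, A4, B4),
    (1, X0, Y5, A5),
    (1, X12, X34, A5),
    (-1, X13, X24, A5),
    (1, X14, X23, A5),
    (1, Y1, X15, B5),
    (1, Y2, X25, B5),
    (1, Y3, X35, B5),
    (1, Y4, X45, B5),
    (-1, W, A5, B5)]"

lemma F_C_eq_form: "F_C = form cartan_terms pvar"
proof -
  have I: "{1..5::nat} = {1, 2, 3, 4, 5}" by auto
  show ?thesis
    unfolding F_C_def q_poly'_def I
    by (simp add: q_poly_def pfaffian_2 delete_row_col_def skew_P_def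
        x0_var_def x_var_def y_var_def a_var_def b_var_def w_var_def
        form_def cartan_terms_def algebra_simps)
qed

text \<open>
  Put \<open>p\<^sub>i = (-1)\<^sup>i\<^sup>-\<^sup>1 Pf(P, i)\<close>. In vector notation the components of the gradient are
  \<open>y \<cdot> a\<close> for \<open>x\<^sub>0\<close>, \<open>x\<^sub>0 a + P b\<close> for \<open>y\<close>, \<open>x\<^sub>0 y + p - w b\<close> for \<open>a\<close>, \<open>- P y - w a\<close> for \<open>b\<close>,
  \<open>- a \<cdot> b\<close> for \<open>w\<close>, and \<open>y\<^sub>i b\<^sub>j - y\<^sub>j b\<^sub>i + \<Sum>\<^sub>k a\<^sub>k \<partial>p\<^sub>k/\<partial>x\<^sub>i\<^sub>j\<close> for \<open>x\<^sub>i\<^sub>j\<close>.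
\<close>

lemma grad_cartan:
  fixes x :: "var \<Rightarrow> 'a::comm_ring_1"
  shows
    "grad cartan_terms x X0 = x Y1 * x A1 + x Y2 * x A2 + x Y3 * x A3 + x Y4 * x A4 + x Y5 * x A5"
    "grad cartan_terms x X12 = - (x Y2 * x B1) + x Y1 * x B2 + x X45 * x A3 - x X35 * x A4 + x X34 * x A5"
    "grad cartan_terms x X13 = - (x Y3 * x B1) - x X45 * x A2 + x Y1 * x B3 + x X25 * x A4 - x X24 * x A5"
    "grad cartan_terms x X14 = - (x Y4 * x B1) + x X35 * x A2 - x X25 * x A3 + x Y1 * x B4 + x X23 * x A5"
    "grad cartan_terms x X15 = - (x Y5 * x B1) - x X34 * x A2 + x X24 * x A3 - x X23 * x A4 + x Y1 * x B5"
    "grad cartan_terms x X23 = x X45 * x A1 - x Y3 * x B2 + x Y2 * x B3 - x X15 * x A4 + x X14 * x A5"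
    "grad cartan_terms x X24 = - (x X35 * x A1) - x Y4 * x B2 + x X15 * x A3 + x Y2 * x B4 - x X13 * x A5"
    "grad cartan_terms x X25 = x X34 * x A1 - x Y5 * x B2 - x X14 * x A3 + x X13 * x A4 + x Y2 * x B5"
    "grad cartan_terms x X34 = x X25 * x A1 - x X15 * x A2 - x Y4 * x B3 + x Y3 * x B4 + x X12 * x A5"
    "grad cartan_terms x X35 = - (x X24 * x A1) + x X14 * x A2 - x Y5 * x B3 - x X12 * x A4 + x Y3 * x B5"
    "grad cartan_terms x X45 = x X23 * x A1 - x X13 * x A2 + x X12 * x A3 - x Y5 * x B4 + x Y4 * x B5"
    "grad cartan_terms x Y1 = x X0 * x A1 + x X12 * x B2 + x X13 * x B3 + x X14 * x B4 + x X15 * x B5"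
    "grad cartan_terms x Y2 = - (x X12 * x B1) + x X0 * x A2 + x X23 * x B3 + x X24 * x B4 + x X25 * x B5"
    "grad cartan_terms x Y3 = - (x X13 * x B1) - x X23 * x B2 + x X0 * x A3 + x X34 * x B4 + x X35 * x B5"
    "grad cartan_terms x Y4 = - (x X14 * x B1) - x X24 * x B2 - x X34 * x B3 + x X0 * x A4 + x X45 * x B5"
    "grad cartan_terms x Y5 = - (x X15 * x B1) - x X25 * x B2 - x X35 * x B3 - x X45 * x B4 + x X0 * x A5"
    "grad cartan_terms x A1 = x X0 * x Y1 + x X23 * x X45 - x X24 * x X35 + x X25 * x X34 - x W * x B1"
    "grad cartan_terms x A2 = x X0 * x Y2 - x X13 * x X45 + x X14 * x X35 - x X15 * x X34 - x W * x B2"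
    "grad cartan_terms x A3 = x X0 * x Y3 + x X12 * x X45 - x X14 * x X25 + x X15 * x X24 - x W * x B3"
    "grad cartan_terms x A4 = x X0 * x Y4 - x X12 * x X35 + x X13 * x X25 - x X15 * x X23 - x W * x B4"
    "grad cartan_terms x A5 = x X0 * x Y5 + x X12 * x X34 - x X13 * x X24 + x X14 * x X23 - x W * x B5"
    "grad cartan_terms x B1 = - (x Y2 * x X12) - x Y3 * x X13 - x Y4 * x X14 - x Y5 * x X15 - x W * x A1"
    "grad cartan_terms x B2 = x Y1 * x X12 - x Y3 * x X23 - x Y4 * x X24 - x Y5 * x X25 - x W * x A2"
    "grad cartan_terms x B3 = x Y1 * x X13 + x Y2 * x X23 - x Y4 * x X34 - x Y5 * x X35 - x W * x A3"
    "grad cartan_terms x B4 = x Y1 * x X14 + x Y2 * x X24 + x Y3 * x X34 - x Y5 * x X45 - x W * x A4"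
    "grad cartan_terms x B5 = x Y1 * x X15 + x Y2 * x X25 + x Y3 * x X35 + x Y4 * x X45 - x W * x A5"
    "grad cartan_terms x W = - (x A1 * x B1) - x A2 * x B2 - x A3 * x B3 - x A4 * x B4 - x A5 * x B5"
  by (simp_all add: grad_def cartan_terms_def)

text \<open>
  The adjoint identity amounts to 27 identities between quartic forms, which hold over every
  commutative ring and are proved by expansion. The case \<open>u = w\<close> shows the mechanism: the left side
  is \<open>- (q - w b) \<cdot> (q' - w a) = - q \<cdot> q' + w (q \<cdot> a + q' \<cdot> b) - w\<^sup>2 a \<cdot> b\<close>, where
  \<open>q = x\<^sub>0 y + p\<close> and \<open>q' = - P y\<close>. Since \<open>P\<close> is skew-symmetric, \<open>P p = 0\<close> and \<open>y\<^sup>T P y = 0\<close>, so \<open>q \<cdot> q' = 0\<close>; what remains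
  is \<open>w F\<close>.
\<close>

lemma adjoint_cartan:
  fixes x :: "var \<Rightarrow> 'a::comm_ring_1"
  shows "grad cartan_terms (grad cartan_terms x) u = form cartan_terms x * x u"
  \<comment> \<open>The outer gradient must be unfolded first, since \<open>grad_cartan\<close> also matches the inner one.\<close>
  by (cases u; simp only: grad_cartan[of "grad cartan_terms x"]; unfold grad_cartan;
      simp add: form_def cartan_terms_def algebra_simps)

theorem mainTheorem3:
  shows "\<exists>Q :: var cpoly ^ var ^ var.
           (\<forall>u v. homogeneous 2 (Q $ u $ v)) \<and> matrix_factorization F_C (hessian F_C) Q"
  unfolding F_C_eq_form by (rule hessian_matrix_factorization) (rule adjoint_cartan)

end
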